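(* $MA_{\omega_1}$ implies that every locally compact and cellular-compact $T_2$ space $X$ of countable spread is compact.
   Context: $T_2$ means Hausdorff. $MA_{\omega_1}$ is Martin's Axiom for $\omega_1$ dense sets: for every ccc partial order and every family of at most $\omega_1$ dense subsets of it there is a filter meeting all of them. A space has countable spread if each of its discrete subspaces is countable. A cellular family in a topological space is a family of pairwise disjoint non-empty open sets. A space $X$ is cellular-compact if for every cellular family $\mathcal{U}$ of open subsets of $X$ there is a compact subspace $K\subset X$ such that $K\cap U\neq\emptyset$ for each $U\in\mathcal{U}$. *)

theory Defs
  imports "HOL-Analysis.Analysis"
begin

definition countable_spread :: "'a topology \<Rightarrow> bool" where
  "countable_spread X \<longleftrightarrow>
     (\<forall>S \<subseteq> topspace X. subtopology X S = discrete_topology S \<longrightarrow> countable S)"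

definition cellular_family :: "'a topology \<Rightarrow> 'a set set \<Rightarrow> bool" where
  "cellular_family X \<U> \<longleftrightarrow> (\<forall>U\<in>\<U>. openin X U \<and> U \<noteq> {}) \<and> pairwise disjnt \<U>"

definition cellular_compact_space :: "'a topology \<Rightarrow> bool" where
  "cellular_compact_space X \<longleftrightarrow>
     (\<forall>\<U>. cellular_family X \<U> \<longrightarrow> (\<exists>K. compactin X K \<and> (\<forall>U\<in>\<U>. K \<inter> U \<noteq> {})))"

text \<open>
  In the forcing notions below, \<open>P\<close> is the carrier, and \<open>(p, q) \<in> r\<close> reads
  ``\<open>p\<close> extends \<open>q\<close>'' (\<open>p \<le> q\<close>).
\<close>

definition forcing_compatible :: "'p set \<Rightarrow> 'p rel \<Rightarrow> 'p \<Rightarrow> 'p \<Rightarrow> bool" where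
  "forcing_compatible P r p q \<longleftrightarrow> (\<exists>s\<in>P. (s, p) \<in> r \<and> (s, q) \<in> r)"

definition forcing_ccc :: "'p set \<Rightarrow> 'p rel \<Rightarrow> bool" where
  "forcing_ccc P r \<longleftrightarrow>
     (\<forall>A \<subseteq> P. pairwise (\<lambda>p q. \<not> forcing_compatible P r p q) A \<longrightarrow> countable A)"

definition forcing_dense :: "'p set \<Rightarrow> 'p rel \<Rightarrow> 'p set \<Rightarrow> bool" where
  "forcing_dense P r D \<longleftrightarrow> D \<subseteq> P \<and> (\<forall>p\<in>P. \<exists>d\<in>D. (d, p) \<in> r)"

definition forcing_filter :: "'p set \<Rightarrow> 'p rel \<Rightarrow> 'p set \<Rightarrow> bool" where
  "forcing_filter P r G \<longleftrightarrow>
     G \<noteq> {} \<and> G \<subseteq> P \<and>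
     (\<forall>p\<in>G. \<forall>q\<in>P. (p, q) \<in> r \<longrightarrow> q \<in> G) \<and>
     (\<forall>p\<in>G. \<forall>q\<in>G. \<exists>s\<in>G. (s, p) \<in> r \<and> (s, q) \<in> r)"

text \<open>
  Martin's axiom for \<open>\<omega>\<^sub>1\<close> dense sets, for the partial orders whose carrier is a
  set of elements of type \<open>'p\<close>; \<open>cardSuc natLeq\<close> is the cardinal \<open>\<omega>\<^sub>1\<close>.
  The empty order is excluded, since it has no filter at all.
\<close>

context
  includes cardinal_syntax
begin

definition MA_omega1 :: "'p itself \<Rightarrow> bool" where
  "MA_omega1 (_ :: 'p itself) \<longleftrightarrow>
     (\<forall>(P :: 'p set) r \<D>.
        P \<noteq> {} \<and> partial_order_on P r \<and> forcing_ccc P r \<and>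
        (\<forall>D\<in>\<D>. forcing_dense P r D) \<and> |\<D>| \<le>o cardSuc natLeq \<longrightarrow>
        (\<exists>G. forcing_filter P r G \<and> (\<forall>D\<in>\<D>. G \<inter> D \<noteq> {})))"

text \<open>
  A formula cannot quantify over the type \<open>'p\<close>.  Nothing is lost by taking the type
  \<open>nat set\<close>, of the cardinality of the continuum: the following lemma shows that this
  instance implies Martin's axiom for the partial orders on every type, because any ccc
  order can be cut down to a suborder with at most \<open>\<omega>\<^sub>1\<close> elements, closed
  under witnesses for compatibility and for density of the given sets.
\<close>

lemma MA_omega1_any_type:
  assumes MA: "MA_omega1 TYPE(nat set)"
  shows "MA_omega1 TYPE('p)"
proof -
  have "\<exists>G. forcing_filter P r G \<and> (\<forall>D\<in>\<D>. G \<inter> D \<noteq> {})"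
    if ne: "P \<noteq> {}" and po: "partial_order_on P r" and ccc: "forcing_ccc P r"
      and dense: "\<forall>D\<in>\<D>. forcing_dense P r D" and card: "|\<D>| \<le>o cardSuc natLeq"
    for P :: "'p set" and r and \<D>
  proof -
    have rP: "r \<subseteq> P \<times> P" and refl: "\<And>p. p \<in> P \<Longrightarrow> (p, p) \<in> r"
      and tr: "trans r" and anti: "antisym r"
      using po by (auto simp: partial_order_on_def preorder_on_def refl_on_def)
    obtain p0 where p0: "p0 \<in> P" using ne by blast
    define f where "f = (\<lambda>(p, q). if forcing_compatible P r p q
        then SOME s. s \<in> P \<and> (s, p) \<in> r \<and> (s, q) \<in> r else p0)"
    define g where "g = (\<lambda>(D, p). SOME d. d \<in> D \<and> (d, p) \<in> r)"
    have f_spec: "f (p, q) \<in> P \<and> (f (p, q), p) \<in> r \<and> (f (p, q), q) \<in> r"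
      if "forcing_compatible P r p q" for p q
    proof -
      have "\<exists>s. s \<in> P \<and> (s, p) \<in> r \<and> (s, q) \<in> r"
        using that unfolding forcing_compatible_def by blast
      from someI_ex[OF this] show ?thesis using that by (simp add: f_def)
    qed
    have fP: "f (p, q) \<in> P" for p q
      using f_spec[of p q] p0 by (cases "forcing_compatible P r p q") (auto simp: f_def)
    have g_spec: "g (D, p) \<in> D \<and> (g (D, p), p) \<in> r" if "D \<in> \<D>" "p \<in> P" for D p
    proof -
      have "\<exists>d. d \<in> D \<and> (d, p) \<in> r"
        using dense that unfolding forcing_dense_def by blast
      from someI_ex[OF this] show ?thesis by (simp add: g_def)
    qed
    have gP: "g (D, p) \<in> P" if "D \<in> \<D>" "p \<in> P" for D p
      using g_spec[OF that] dense that unfolding forcing_dense_def by blast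
    define step where "step = (\<lambda>S. S \<union> (f ` (S \<times> S) \<union> g ` (\<D> \<times> S)))"
    define Qn where "Qn = (\<lambda>n. (step ^^ n) {p0})"
    define Q where "Q = (\<Union>n. Qn n)"
    have Qn_Suc: "Qn (Suc n) = step (Qn n)" for n by (simp add: Qn_def)
    have Qn_0: "Qn 0 = {p0}" by (simp add: Qn_def)
    have Qn_P: "Qn n \<subseteq> P" for n
      by (induction n) (use p0 fP gP in \<open>auto simp: Qn_0 Qn_Suc step_def\<close>)
    have QP: "Q \<subseteq> P" using Qn_P by (auto simp: Q_def)
    have Qn_mono: "Qn m \<subseteq> Qn n" if "m \<le> n" for m n
      using that by (rule lift_Suc_mono_le[rotated]) (auto simp: Qn_Suc step_def)
    have p0Q: "p0 \<in> Q" using Qn_0 unfolding Q_def by blast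
    have fQ: "f (p, q) \<in> Q" if "p \<in> Q" "q \<in> Q" for p q
    proof -
      obtain m n where "p \<in> Qn m" "q \<in> Qn n" using \<open>p \<in> Q\<close> \<open>q \<in> Q\<close> by (auto simp: Q_def)
      then have "p \<in> Qn (max m n)" "q \<in> Qn (max m n)"
        using Qn_mono[of m "max m n"] Qn_mono[of n "max m n"] by auto
      then have "f (p, q) \<in> Qn (Suc (max m n))" by (auto simp: Qn_Suc step_def)
      then show ?thesis by (auto simp: Q_def)
    qed
    have gQ: "g (D, p) \<in> Q" if "D \<in> \<D>" "p \<in> Q" for D p
    proof -
      obtain m where "p \<in> Qn m" using \<open>p \<in> Q\<close> by (auto simp: Q_def)
      then have "g (D, p) \<in> Qn (Suc m)" using that by (auto simp: Qn_Suc step_def)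
      then show ?thesis by (auto simp: Q_def)
    qed
    have co: "Card_order (cardSuc natLeq)"
      by (rule cardSuc_Card_order[OF natLeq_Card_order])
    have inf: "infinite (Field (cardSuc natLeq))"
      using cardSuc_finite[OF natLeq_Card_order] by (simp add: Field_natLeq)
    have Un_le: "|A \<union> B| \<le>o cardSuc natLeq"
      if "|A| \<le>o cardSuc natLeq" "|B| \<le>o cardSuc natLeq" for A B :: "'p set"
      using card_of_Un_ordLeq_infinite_Field[OF inf that co] .
    have Qn_le: "|Qn n| \<le>o cardSuc natLeq" for n
    proof (induction n)
      case 0
      show ?case unfolding Qn_0
        by (rule ordLeq_transitive[OF ordLess_imp_ordLeq cardSuc_ordLeq[OF natLeq_Card_order]])
          (simp add: finite_iff_ordLess_natLeq[symmetric])
    next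
      case (Suc n)
      have "|f ` (Qn n \<times> Qn n)| \<le>o cardSuc natLeq"
        by (rule ordLeq_transitive[OF card_of_image
              card_of_Times_ordLeq_infinite_Field[OF inf Suc Suc co]])
      moreover have "|g ` (\<D> \<times> Qn n)| \<le>o cardSuc natLeq"
        by (rule ordLeq_transitive[OF card_of_image
              card_of_Times_ordLeq_infinite_Field[OF inf card Suc co]])
      ultimately show ?case unfolding Qn_Suc step_def using Suc by (intro Un_le)
    qed
    have natle: "|UNIV :: nat set| \<le>o cardSuc natLeq"
      by (rule ordIso_ordLeq_trans[OF card_of_nat cardSuc_ordLeq[OF natLeq_Card_order]])
    have "|Q| \<le>o cardSuc natLeq"
      unfolding Q_def using card_of_UNION_ordLeq_infinite_Field[OF inf co natle] Qn_le by blast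
    moreover have "cardSuc natLeq \<le>o |UNIV :: nat set set|"
    proof (rule cardSuc_least[OF natLeq_Card_order card_of_Card_order])
      show "natLeq <o |UNIV :: nat set set|"
        using ordIso_ordLess_trans[OF ordIso_symmetric[OF card_of_nat]
            card_of_Pow[of "UNIV :: nat set"]] by simp
    qed
    ultimately have "|Q| \<le>o |UNIV :: nat set set|" by (rule ordLeq_transitive)
    then obtain h :: "'p \<Rightarrow> nat set" where h: "inj_on h Q"
      unfolding card_of_ordLeq[symmetric] by blast
    define r' where "r' = {(h a, h b) | a b. a \<in> Q \<and> b \<in> Q \<and> (a, b) \<in> r}"
    have r'_iff: "(h a, h b) \<in> r' \<longleftrightarrow> (a, b) \<in> r" if "a \<in> Q" "b \<in> Q" for a b
      using that h unfolding r'_def by (auto dest: inj_onD)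
    have "partial_order_on (h ` Q) r'"
      unfolding partial_order_on_def preorder_on_def refl_on_def
    proof (intro conjI ballI)
      show "r' \<subseteq> h ` Q \<times> h ` Q" by (auto simp: r'_def)
      show "(x, x) \<in> r'" if "x \<in> h ` Q" for x
        using that refl QP by (auto simp: r'_iff)
      show "trans r'"
      proof (rule transI)
        fix x y z assume "(x, y) \<in> r'" "(y, z) \<in> r'"
        then obtain a b c where *: "x = h a" "y = h b" "z = h c" "a \<in> Q" "b \<in> Q" "c \<in> Q"
          by (auto simp: r'_def)
        with \<open>(x, y) \<in> r'\<close> \<open>(y, z) \<in> r'\<close> tr show "(x, z) \<in> r'"
          by (auto simp: r'_iff dest: transD)
      qed
      show "antisym r'"
      proof (rule antisymI)
        fix x y assume "(x, y) \<in> r'" "(y, x) \<in> r'"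
        then obtain a b where *: "x = h a" "y = h b" "a \<in> Q" "b \<in> Q"
          by (auto simp: r'_def)
        with \<open>(x, y) \<in> r'\<close> \<open>(y, x) \<in> r'\<close> anti show "x = y"
          by (auto simp: r'_iff dest: antisymD)
      qed
    qed
    moreover have "forcing_ccc (h ` Q) r'"
      unfolding forcing_ccc_def
    proof (intro allI impI)
      fix A assume A: "A \<subseteq> h ` Q"
        and pw: "pairwise (\<lambda>p q. \<not> forcing_compatible (h ` Q) r' p q) A"
      obtain B where B: "B \<subseteq> Q" "A = h ` B" using A by (auto simp: subset_image_iff)
      have "pairwise (\<lambda>p q. \<not> forcing_compatible P r p q) B"
        unfolding pairwise_def
      proof (intro ballI impI notI)
        fix p q assume pq: "p \<in> B" "q \<in> B" "p \<noteq> q" and c: "forcing_compatible P r p q"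
        have "p \<in> Q" "q \<in> Q" using pq B by auto
        then have "forcing_compatible (h ` Q) r' (h p) (h q)"
          unfolding forcing_compatible_def
          using f_spec[OF c] fQ[of p q] by (intro bexI[of _ "h (f (p, q))"]) (auto simp: r'_iff)
        moreover have "h p \<noteq> h q" using h \<open>p \<in> Q\<close> \<open>q \<in> Q\<close> pq(3) by (auto dest: inj_onD)
        ultimately show False using pw pq B(2) by (auto simp: pairwise_def)
      qed
      then have "countable B" using ccc B(1) QP unfolding forcing_ccc_def by blast
      then show "countable A" using B(2) by simp
    qed
    moreover have "\<forall>D'\<in>(\<lambda>D. h ` (D \<inter> Q)) ` \<D>. forcing_dense (h ` Q) r' D'"
    proof
      fix D' assume "D' \<in> (\<lambda>D. h ` (D \<inter> Q)) ` \<D>"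
      then obtain D where D: "D \<in> \<D>" "D' = h ` (D \<inter> Q)" by blast
      show "forcing_dense (h ` Q) r' D'"
        unfolding forcing_dense_def
      proof (intro conjI ballI)
        show "D' \<subseteq> h ` Q" using D by auto
        fix x assume "x \<in> h ` Q"
        then obtain p where p: "p \<in> Q" "x = h p" by blast
        then have "g (D, p) \<in> D \<inter> Q" "(g (D, p), p) \<in> r"
          using g_spec[OF D(1), of p] gQ[OF D(1) p(1)] QP by auto
        then show "\<exists>d\<in>D'. (d, x) \<in> r'"
          unfolding D(2) p(2) using p(1) by (intro bexI[of _ "h (g (D, p))"]) (auto simp: r'_iff)
      qed
    qed
    moreover have "|(\<lambda>D. h ` (D \<inter> Q)) ` \<D>| \<le>o cardSuc natLeq"
      by (rule ordLeq_transitive[OF card_of_image card])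
    moreover have "h ` Q \<noteq> {}" using p0Q by blast
    ultimately obtain G' where G': "forcing_filter (h ` Q) r' G'"
      and meets: "\<forall>D'\<in>(\<lambda>D. h ` (D \<inter> Q)) ` \<D>. G' \<inter> D' \<noteq> {}"
      using MA[unfolded MA_omega1_def, rule_format, of "h ` Q" r' "(\<lambda>D. h ` (D \<inter> Q)) ` \<D>"]
      by blast
    define G where "G = {p \<in> P. \<exists>q\<in>Q. h q \<in> G' \<and> (q, p) \<in> r}"
    have QG: "q \<in> G" if "q \<in> Q" "h q \<in> G'" for q
      using that refl QP unfolding G_def by blast
    have "forcing_filter P r G"
      unfolding forcing_filter_def
    proof (intro conjI ballI impI)
      obtain q where "q \<in> Q" "h q \<in> G'" using G' unfolding forcing_filter_def by blast
      then show "G \<noteq> {}" using QG by blast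
      show "G \<subseteq> P" by (auto simp: G_def)
      show "q \<in> G" if "p \<in> G" "q \<in> P" "(p, q) \<in> r" for p q
        using that tr unfolding G_def by (blast dest: transD)
      show "\<exists>s\<in>G. (s, p) \<in> r \<and> (s, q) \<in> r" if "p \<in> G" "q \<in> G" for p q
      proof -
        obtain a b where ab: "a \<in> Q" "b \<in> Q" "h a \<in> G'" "h b \<in> G'" "(a, p) \<in> r" "(b, q) \<in> r"
          using \<open>p \<in> G\<close> \<open>q \<in> G\<close> unfolding G_def by blast
        then obtain s' where "s' \<in> G'" "(s', h a) \<in> r'" "(s', h b) \<in> r'"
          using G' unfolding forcing_filter_def by blast
        moreover from this G' obtain s where "s \<in> Q" "s' = h s"
          unfolding forcing_filter_def by blast
        ultimately have "s \<in> G" "(s, a) \<in> r" "(s, b) \<in> r"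
          using ab QG by (auto simp: r'_iff)
        with ab tr show ?thesis by (blast dest: transD)
      qed
    qed
    moreover have "\<forall>D\<in>\<D>. G \<inter> D \<noteq> {}"
    proof
      fix D assume "D \<in> \<D>"
      then obtain q where "q \<in> D" "q \<in> Q" "h q \<in> G'" using meets by blast
      then show "G \<inter> D \<noteq> {}" using QG by blast
    qed
    ultimately show ?thesis by blast
  qed
  then show ?thesis unfolding MA_omega1_def by blast
qed

end

end

theory Submission
  imports Defs "HOL-Library.Countable_Set_Type"
begin

text \<open>
  The heart of the matter is a theorem of Szentmiklossy: under Martin's axiom for
  \<open>\<omega>\<^sub>1\<close> dense sets, a compact Hausdorff space of countable spread is hereditarily
  Lindelof (\<open>MA_hereditarily_Lindelof\<close>).  If it were not, there would be points \<open>x a\<close> with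
  open neighbourhoods \<open>V a\<close>, for \<open>a < \<omega>\<^sub>1\<close>, such that \<open>V a\<close> contains no later point.
  Shrink \<open>V a\<close> to \<open>U a\<close> and force with the finite sets of indices whose points are
  pairwise separated by the sets \<open>U a\<close>.  If this order is ccc, Martin's axiom yields an
  uncountable discrete subspace, against countable spread.  If it is not, an uncountable
  antichain can be thinned out to increasing blocks of \<open>n\<close> indices each
  (\<open>uncountable_clique_or_incompatible_blocks\<close>), and the corresponding \<open>n\<close>-tuples of
  points form an uncountable free sequence in \<open>X\<^sup>n\<close>: an initial segment has its closure
  inside an open set that all later tuples avoid.  This too is impossible, because countable
  spread makes the compact space \<open>X\<close> countably tight
  (\<open>countable_spread_imp_countably_tight\<close>), finite powers of compact Hausdorff spaces
  inherit countable tightness (\<open>countably_tight_finite_power\<close>), and a countably tight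
  compact space has no uncountable free sequences (\<open>no_long_free_sequence\<close>).

  A locally compact Hausdorff space of countable spread has a compact one-point
  compactification, again of countable spread; so it is a countable union of open sets
  with compact closures.  If it is not compact, the differences between suitably spaced
  stages of an increasing such union are infinitely many pairwise disjoint nonempty open
  sets, and a compact set, being contained in one stage, cannot meet all of them.  This
  contradicts cellular-compactness (\<open>cellular_compact_imp_compact\<close>).
\<close>

section \<open>Countable tightness from countable spread\<close>

text \<open>
  A maximal \<open>R\<close>-clique exists by Zorn's lemma, and being maximal it cannot be countable.
  This replaces transfinite recursion of length \<open>\<omega>\<^sub>1\<close> wherever the order in which the
  elements are chosen does not matter.
\<close>

lemma uncountable_pairwise:
  assumes extend: "\<And>C. \<lbrakk>C \<subseteq> S; countable C; pairwise R C\<rbrakk> \<Longrightarrow> \<exists>x\<in>S - C. \<forall>c\<in>C. R c x \<and> R x c"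
  shows "\<exists>C\<subseteq>S. uncountable C \<and> pairwise R C"
proof -
  define \<A> where "\<A> = {C. C \<subseteq> S \<and> pairwise R C}"
  have "\<exists>M\<in>\<A>. \<forall>C\<in>\<A>. M \<subseteq> C \<longrightarrow> C = M"
  proof (rule subset_Zorn')
    fix \<C> assume "subset.chain \<A> \<C>"
    then have "chain\<^sub>\<subseteq> \<C>" and sub: "\<And>D. D \<in> \<C> \<Longrightarrow> D \<subseteq> S \<and> pairwise R D"
      unfolding subset_chain_def chain_subset_def \<A>_def by blast+
    then have "pairwise R (\<Union>\<C>)" by (meson pairwise_chain_Union)
    moreover have "\<Union>\<C> \<subseteq> S" by (rule Union_least) (use sub in blast)
    ultimately show "\<Union>\<C> \<in> \<A>" by (simp add: \<A>_def)
  qed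
  then obtain M where "M \<in> \<A>" and max: "\<And>C. \<lbrakk>C \<in> \<A>; M \<subseteq> C\<rbrakk> \<Longrightarrow> C = M" by metis
  then have M: "M \<subseteq> S" "pairwise R M" by (simp_all add: \<A>_def)
  have "uncountable M"
  proof
    assume "countable M"
    then obtain x where x: "x \<in> S - M" "\<forall>c\<in>M. R c x \<and> R x c" using extend M by blast
    then have "pairwise R (insert x M)" using M(2) by (auto simp: pairwise_insert)
    then have "insert x M \<in> \<A>" using x M(1) by (simp add: \<A>_def)
    then have "insert x M = M" using max by blast
    then show False using x by blast
  qed
  with M show ?thesis by blast
qed

text \<open>
  Countable spread in the form in which it gets contradicted: for families of points that
  may be indexed with repetitions a priori.
\<close>

lemma countable_spread_isolated:
  assumes spread: "countable_spread X"
    and isolated: "\<And>a. a \<in> A \<Longrightarrow> \<exists>U. openin X U \<and> f a \<in> U \<and> (\<forall>b\<in>A. b \<noteq> a \<longrightarrow> f b \<notin> U)"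
  shows "countable A"
proof -
  have sub: "f ` A \<subseteq> topspace X" using isolated openin_subset by blast
  have "openin (subtopology X (f ` A)) {f a}" if a: "a \<in> A" for a
  proof -
    obtain U where "openin X U" "f a \<in> U" "\<forall>b\<in>A. b \<noteq> a \<longrightarrow> f b \<notin> U" using isolated[OF a] by blast
    moreover from this have "{f a} = U \<inter> f ` A" using a by auto
    ultimately show ?thesis unfolding openin_subtopology by blast
  qed
  then have "discrete_topology (f ` A) = subtopology X (f ` A)"
    using sub unfolding discrete_topology_unique by auto
  then have "countable (f ` A)" using spread sub unfolding countable_spread_def by metis
  moreover have "inj_on f A" using isolated by (metis inj_onI)
  ultimately show ?thesis by (rule countable_image_inj_on)
qed

definition countably_directed :: "'a set set \<Rightarrow> bool" where
  "countably_directed \<F> \<longleftrightarrow> (\<forall>\<C>\<subseteq>\<F>. countable \<C> \<longrightarrow> (\<exists>F\<in>\<F>. \<Union>\<C> \<subseteq> F))"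

lemma countably_directedD:
  "\<lbrakk>countably_directed \<F>; \<C> \<subseteq> \<F>; countable \<C>\<rbrakk> \<Longrightarrow> \<exists>F\<in>\<F>. \<Union>\<C> \<subseteq> F"
  unfolding countably_directed_def by simp

text \<open>
  The usual formulation (each point of the closure of a set lies in the closure of a countable
  subset) is equivalent: the closures of the countable subsets of \<open>A\<close> form a countably
  directed family, whose union is contained in every set that contains \<open>A\<close> and is closed
  under closures of countable subsets.  Closedness of directed unions is what the product
  theorem and the exclusion of free sequences use directly.
\<close>

definition countably_tight :: "'a topology \<Rightarrow> bool" where
  "countably_tight X \<longleftrightarrow>
     (\<forall>\<F>. (\<forall>F\<in>\<F>. closedin X F) \<and> countably_directed \<F> \<longrightarrow> closedin X (\<Union>\<F>))"

lemma countably_tightD: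
  "\<lbrakk>countably_tight X; countably_directed \<F>; \<And>F. F \<in> \<F> \<Longrightarrow> closedin X F\<rbrakk> \<Longrightarrow> closedin X (\<Union>\<F>)"
  unfolding countably_tight_def by simp

lemma regular_space_closed_neighbourhood:
  assumes "regular_space X" "openin X W" "x \<in> W"
  obtains U V where "openin X U" "closedin X V" "x \<in> U" "U \<subseteq> V" "V \<subseteq> W"
  using assms unfolding neighbourhood_base_of_closedin[symmetric] neighbourhood_base_of by meson

lemma closure_of_meets_open:
  "\<lbrakk>z \<in> X closure_of S; openin X T; z \<in> T\<rbrakk> \<Longrightarrow> \<exists>w\<in>S. w \<in> T"
  unfolding in_closure_of by blast

lemma closedin_if_closure_of_subset: "E \<subseteq> topspace X \<Longrightarrow> X closure_of E \<subseteq> E \<Longrightarrow> closedin X E"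
  by (metis closure_of_subset closure_of_eq subset_antisym)

lemma compact_space_closed_family_meets:
  assumes compact: "compact_space X" and C: "closedin X C"
    and N: "\<And>i. i \<in> A \<Longrightarrow> closedin X (N i)"
    and finite_meets: "\<And>B. \<lbrakk>finite B; B \<subseteq> A\<rbrakk> \<Longrightarrow> \<exists>x\<in>C. \<forall>i\<in>B. x \<in> N i"
  shows "\<exists>x\<in>C. \<forall>i\<in>A. x \<in> N i"
proof -
  let ?\<U> = "insert C (N ` A)"
  have "\<forall>D\<in>?\<U>. closedin X D" using C N by auto
  moreover have "\<Inter>\<E> \<noteq> {}" if \<E>: "finite \<E>" "\<E> \<subseteq> ?\<U>" for \<E>
  proof -
    have "finite (\<E> - {C})" "\<E> - {C} \<subseteq> N ` A" using \<E> by auto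
    then obtain B where B: "B \<subseteq> A" "finite B" "\<E> - {C} = N ` B" by (meson finite_subset_image)
    obtain x where x: "x \<in> C" "\<forall>i\<in>B. x \<in> N i" using finite_meets[OF B(2,1)] by blast
    have "x \<in> D" if "D \<in> \<E>" for D
    proof (cases "D = C")
      case False
      then have "D \<in> N ` B" using that B(3) by blast
      then show ?thesis using x by blast
    qed (simp add: x)
    then show ?thesis by blast
  qed
  ultimately have "\<Inter>?\<U> \<noteq> {}"
    by (intro compact[unfolded compact_space_fip, THEN spec[of _ ?\<U>], THEN mp] conjI) blast+
  then show ?thesis by auto
qed

text \<open>
  Suppose that \<open>z\<close> is in the closure of the union of a countably directed family, but in none
  of its members \<open>F\<close>.  Separate \<open>z\<close> from each \<open>F\<close> by a closed neighbourhood \<open>N F\<close>.  By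
  compactness and directedness, any countably many of these neighbourhoods have a common
  point in the union.  So points can be chosen again and again, each one inside the
  neighbourhoods attached to the earlier points and each earlier point inside the member
  attached to the later ones: an uncountable free sequence, hence a discrete subspace.
\<close>

lemma countable_spread_imp_countably_tight:
  assumes compact: "compact_space X" and Haus: "Hausdorff_space X" and spread: "countable_spread X"
  shows "countably_tight X"
  unfolding countably_tight_def
proof (intro allI impI, elim conjE)
  fix \<F> assume closed: "\<forall>F\<in>\<F>. closedin X F" and dir: "countably_directed \<F>"
  show "closedin X (\<Union>\<F>)"
  proof (rule closedin_if_closure_of_subset)
    show "\<Union>\<F> \<subseteq> topspace X" using closed closedin_subset by blast
    show "X closure_of \<Union>\<F> \<subseteq> \<Union>\<F>"
    proof (rule subsetI, rule ccontr)
      fix z assume z: "z \<in> X closure_of \<Union>\<F>" and znot: "z \<notin> \<Union>\<F>"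
      have "\<exists>O' N. openin X O' \<and> closedin X N \<and> z \<in> O' \<and> O' \<subseteq> N \<and> N \<inter> F = {}" if "F \<in> \<F>" for F
      proof -
        have "openin X (topspace X - F)" "z \<in> topspace X - F"
          using closed that z znot by (auto simp: in_closure_of)
        from regular_space_closed_neighbourhood[OF compact_Hausdorff_imp_regular_space[OF compact Haus] this]
        show ?thesis by (metis Diff_disjoint Int_commute disjoint_iff subsetD)
      qed
      then obtain O' N where O': "\<And>F. F \<in> \<F> \<Longrightarrow> openin X (O' F)" "\<And>F. F \<in> \<F> \<Longrightarrow> z \<in> O' F"
        and N: "\<And>F. F \<in> \<F> \<Longrightarrow> closedin X (N F)" "\<And>F. F \<in> \<F> \<Longrightarrow> O' F \<subseteq> N F"
          "\<And>F. F \<in> \<F> \<Longrightarrow> N F \<inter> F = {}"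
        by metis
      \<comment> \<open>Compactness is applied inside a single member \<open>G\<close> that is large enough to contain a
      witness for each of the countably many finite intersections.\<close>
      have meet: "\<exists>x. \<exists>G\<in>\<F>. x \<in> G \<and> (\<forall>F\<in>\<C>. x \<in> N F)" if \<C>: "\<C> \<subseteq> \<F>" "countable \<C>" for \<C>
      proof -
        have "\<exists>G\<in>\<F>. \<exists>w\<in>G. \<forall>F\<in>\<B>. w \<in> N F" if \<B>: "\<B> \<in> {\<B>. finite \<B> \<and> \<B> \<subseteq> \<C>}" for \<B>
        proof -
          have "openin X (topspace X \<inter> \<Inter>(O' ` \<B>))"
            using \<B> \<C> O'(1) by (cases "\<B> = {}") (auto intro!: openin_Int openin_Inter)
          moreover have "z \<in> topspace X \<inter> \<Inter>(O' ` \<B>)"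
            using \<B> \<C> O'(2) z by (auto simp: in_closure_of)
          ultimately obtain w where w: "w \<in> \<Union>\<F>" "w \<in> topspace X \<inter> \<Inter>(O' ` \<B>)"
            using closure_of_meets_open[OF z] by metis
          then obtain G where "G \<in> \<F>" "w \<in> G" "\<forall>F\<in>\<B>. w \<in> O' F" by blast
          moreover have "\<forall>F\<in>\<B>. O' F \<subseteq> N F" using \<B> \<C>(1) N(2) by auto
          ultimately show ?thesis by (meson subsetD)
        qed
        then obtain g where g: "\<And>\<B>. finite \<B> \<Longrightarrow> \<B> \<subseteq> \<C> \<Longrightarrow> g \<B> \<in> \<F> \<and> (\<exists>w\<in>g \<B>. \<forall>F\<in>\<B>. w \<in> N F)"
          by (metis (mono_tags, lifting) mem_Collect_eq)
        have "countable (g ` {\<B>. finite \<B> \<and> \<B> \<subseteq> \<C>})"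
          using \<C>(2) by (intro countable_image countable_Collect_finite_subset)
        moreover have "g ` {\<B>. finite \<B> \<and> \<B> \<subseteq> \<C>} \<subseteq> \<F>" using g by auto
        ultimately obtain G where G: "G \<in> \<F>" "\<Union>(g ` {\<B>. finite \<B> \<and> \<B> \<subseteq> \<C>}) \<subseteq> G"
          using countably_directedD[OF dir] by metis
        have "\<exists>x\<in>G. \<forall>F\<in>\<C>. x \<in> N F"
        proof (rule compact_space_closed_family_meets[OF compact])
          show "closedin X G" using G closed by blast
          show "closedin X (N F)" if "F \<in> \<C>" for F using that N(1) \<C> by blast
          fix \<B> assume \<B>: "finite \<B>" "\<B> \<subseteq> \<C>"
          with g[OF \<B>] G(2) show "\<exists>x\<in>G. \<forall>F\<in>\<B>. x \<in> N F" by blast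
        qed
        with G(1) show ?thesis by blast
      qed
      \<comment> \<open>In a triple \<open>(x, F, G)\<close>, the set \<open>F\<close> holds all points chosen before \<open>x\<close>, and
      \<open>N G\<close> will contain all points chosen after it; so \<open>x\<close> is isolated by the
      complement of \<open>F \<union> N G\<close>.\<close>
      define S where "S = {(x, F, G). F \<in> \<F> \<and> G \<in> \<F> \<and> x \<in> N F \<and> x \<in> G}"
      define prec where "prec = (\<lambda>(x :: 'a, F :: 'a set, G) (x', F', G' :: 'a set). G \<subseteq> F' \<and> x' \<in> N G)"
      have "\<exists>C\<subseteq>S. uncountable C \<and> pairwise (\<lambda>e e'. prec e e' \<or> prec e' e) C"
      proof (rule uncountable_pairwise)
        fix C assume C: "C \<subseteq> S" "countable C"
        define \<C> where "\<C> = (\<lambda>(x, F, G). G) ` C"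
        have "\<C> \<subseteq> \<F>" "countable \<C>" using C by (auto simp: \<C>_def S_def)
        from countably_directedD[OF dir this] obtain F where F: "F \<in> \<F>" "\<Union>\<C> \<subseteq> F" by metis
        obtain x G where x: "G \<in> \<F>" "x \<in> G" "\<forall>F\<in>insert F \<C>. x \<in> N F"
          using meet[of "insert F \<C>"] F(1) \<open>\<C> \<subseteq> \<F>\<close> \<open>countable \<C>\<close> by (metis countable_insert insert_subset)
        have "(x, F, G) \<in> S" using F x by (simp add: S_def)
        moreover have "(x, F, G) \<notin> C"
        proof
          assume "(x, F, G) \<in> C"
          then have "G \<in> \<C>" by (force simp: \<C>_def)
          then show False using x N(3)[of G] by auto
        qed
        moreover have "prec e (x, F, G)" if "e \<in> C" for e
        proof -
          obtain y H K where e: "e = (y, H, K)" by (cases e)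
          then have "K \<in> \<C>" using that by (force simp: \<C>_def)
          then show ?thesis using F x e by (auto simp: prec_def)
        qed
        ultimately show "\<exists>e'\<in>S - C. \<forall>e\<in>C. (prec e e' \<or> prec e' e) \<and> (prec e' e \<or> prec e e')"
          by blast
      qed
      then obtain C where C: "C \<subseteq> S" "uncountable C" "pairwise (\<lambda>e e'. prec e e' \<or> prec e' e) C"
        by blast
      have "countable C"
      proof (rule countable_spread_isolated[OF spread, where f = fst])
        fix e assume e: "e \<in> C"
        obtain x F G where [simp]: "e = (x, F, G)" by (cases e)
        have e': "F \<in> \<F>" "G \<in> \<F>" "x \<in> N F" "x \<in> G" using e C(1) by (auto simp: S_def)
        have "fst d \<notin> topspace X - F - N G" if d: "d \<in> C" "d \<noteq> e" for d
        proof -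
          obtain y H K where [simp]: "d = (y, H, K)" by (cases d)
          have "y \<in> K" using d C(1) by (auto simp: S_def)
          moreover have "prec e d \<or> prec d e" using C(3) d e by (auto simp: pairwise_def)
          ultimately show ?thesis by (auto simp: prec_def)
        qed
        moreover have "openin X (topspace X - F - N G)"
          using e' closed N(1) by (intro openin_diff) auto
        moreover have "fst e \<in> topspace X - F - N G"
          using e' N(3)[of F] N(3)[of G] closedin_subset[OF N(1)[of F]] by auto
        ultimately show "\<exists>U. openin X U \<and> fst e \<in> U \<and> (\<forall>d\<in>C. d \<noteq> e \<longrightarrow> fst d \<notin> U)"
          by blast
      qed
      with C(2) show False by simp
    qed
  qed
qed

section \<open>Finite powers and free sequences\<close>

text \<open>
  Let \<open>z\<close> be in the closure of the union of the family.  The union contains points that are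
  close to \<open>z\<close> in every coordinate; one coordinate after the other can be made equal to
  that of \<open>z\<close>.  For this, fix the coordinates already treated and bound the remaining ones
  by closed neighbourhoods: the projections of the family, so restricted, to the next
  coordinate are compact and countably directed, so their union is closed by the tightness
  of \<open>X\<close>, and \<open>z k\<close> belongs to its closure.
\<close>

lemma countably_tight_finite_power:
  assumes compact: "compact_space X" and Haus: "Hausdorff_space X" and tight: "countably_tight X"
    and I: "finite I"
  shows "countably_tight (product_topology (\<lambda>_. X) I)" (is "countably_tight ?Y")
  unfolding countably_tight_def
proof (intro allI impI, elim conjE)
  fix \<F> assume closed: "\<forall>F\<in>\<F>. closedin ?Y F" and dir: "countably_directed \<F>"
  have Ycompact: "compact_space ?Y" using compact by (simp add: compact_space_product_topology)
  show "closedin ?Y (\<Union>\<F>)"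
  proof (rule closedin_if_closure_of_subset)
    show E: "\<Union>\<F> \<subseteq> topspace ?Y" using closed closedin_subset by blast
    show "?Y closure_of \<Union>\<F> \<subseteq> \<Union>\<F>"
    proof
      fix z assume z: "z \<in> ?Y closure_of \<Union>\<F>"
      then have zY: "z \<in> PiE I (\<lambda>_. topspace X)" by (simp add: in_closure_of)
      have approx: "\<exists>w\<in>\<Union>\<F>. (\<forall>i\<in>I. w i \<in> N i) \<and> (\<forall>i\<in>J. w i = z i)"
        if "finite J" "J \<subseteq> I"
          and "\<And>i. i \<in> I \<Longrightarrow> closedin X (N i) \<and> (\<exists>U. openin X U \<and> z i \<in> U \<and> U \<subseteq> N i)" for J N
        using that
      proof (induction J arbitrary: N)
        case empty
        then have "\<forall>i\<in>I. \<exists>U. openin X U \<and> z i \<in> U \<and> U \<subseteq> N i" by blast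
        then obtain U where U: "\<And>i. i \<in> I \<Longrightarrow> openin X (U i) \<and> z i \<in> U i \<and> U i \<subseteq> N i" by metis
        have "openin ?Y (PiE I U)" using I U by (simp add: openin_PiE_gen)
        moreover have "z \<in> PiE I U" using U zY by (auto simp: PiE_iff)
        ultimately obtain w where "w \<in> \<Union>\<F>" "w \<in> PiE I U" using closure_of_meets_open[OF z] by metis
        then show ?case using U by (intro bexI[of _ w]) (auto simp: PiE_iff)
      next
        case (insert k J)
        \<comment> \<open>Coordinate \<open>k\<close> is left free here; the bound \<open>N k\<close> on it is automatic once it equals \<open>z k\<close>.\<close>
        define Box where
          "Box = PiE I (\<lambda>i. if i \<in> J then {z i} else if i = k then topspace X else N i)"
        have k: "k \<in> I" using insert.prems by blast
        have "closedin ?Y Box"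
          unfolding Box_def closedin_product_topology using insert.prems(2) zY
          by (auto simp: closedin_Hausdorff_sing_eq[OF Haus] PiE_iff)
        then have img: "closedin X ((\<lambda>w. w k) ` (F \<inter> Box))" if "F \<in> \<F>" for F
          using closed that Ycompact k
          by (intro compactin_imp_closedin[OF Haus] image_compactin[where X = ?Y] closedin_compact_space)
            (auto intro: continuous_map_product_projection)
        define \<G> where "\<G> = (\<lambda>F. (\<lambda>w. w k) ` (F \<inter> Box)) ` \<F>"
        have "countably_directed \<G>"
          unfolding countably_directed_def
        proof (intro allI impI)
          fix \<C> assume "\<C> \<subseteq> \<G>" "countable \<C>"
          then obtain \<D> where \<D>: "\<D> \<subseteq> \<F>" "countable \<D>" "\<C> = (\<lambda>F. (\<lambda>w. w k) ` (F \<inter> Box)) ` \<D>"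
            unfolding \<G>_def by (meson countable_subset_image)
          then obtain F where "F \<in> \<F>" "\<Union>\<D> \<subseteq> F" using countably_directedD[OF dir \<D>(1,2)] by metis
          then show "\<exists>G\<in>\<G>. \<Union>\<C> \<subseteq> G" unfolding \<G>_def \<D>(3) by blast
        qed
        then have clG: "closedin X (\<Union>\<G>)"
          by (rule countably_tightD[OF tight]) (use img in \<open>auto simp: \<G>_def\<close>)
        have "z k \<in> \<Union>\<G>"
        proof (rule ccontr)
          assume "z k \<notin> \<Union>\<G>"
          then have "openin X (topspace X - \<Union>\<G>)" "z k \<in> topspace X - \<Union>\<G>"
            using clG zY k by (auto simp: PiE_iff)
          then obtain U V where UV: "openin X U" "closedin X V" "z k \<in> U" "U \<subseteq> V" "V \<subseteq> topspace X - \<Union>\<G>"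
            using regular_space_closed_neighbourhood[OF compact_Hausdorff_imp_regular_space[OF compact Haus]] by metis
          obtain O' where O': "openin X O'" "z k \<in> O'" "O' \<subseteq> N k" using insert.prems(2)[OF k] by blast
          have "\<exists>w\<in>\<Union>\<F>. (\<forall>i\<in>I. w i \<in> (N(k := N k \<inter> V)) i) \<and> (\<forall>i\<in>J. w i = z i)"
          proof (rule insert.IH)
            show "J \<subseteq> I" using insert.prems by blast
            fix i assume "i \<in> I"
            show "closedin X ((N(k := N k \<inter> V)) i) \<and>
                (\<exists>U. openin X U \<and> z i \<in> U \<and> U \<subseteq> (N(k := N k \<inter> V)) i)"
            proof (cases "i = k")
              case True
              have "closedin X (N k \<inter> V)" using insert.prems(2)[OF k] UV by blast
              moreover have "openin X (O' \<inter> U)" using O' UV by blast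
              moreover have "z k \<in> O' \<inter> U" "O' \<inter> U \<subseteq> N k \<inter> V" using O' UV by auto
              ultimately show ?thesis using True by auto
            qed (use insert.prems(2)[OF \<open>i \<in> I\<close>] in auto)
          qed
          then obtain w F where w: "F \<in> \<F>" "w \<in> F" "\<forall>i\<in>I. w i \<in> (N(k := N k \<inter> V)) i" "\<forall>i\<in>J. w i = z i"
            by blast
          have "w \<in> PiE I (\<lambda>_. topspace X)" using w E by auto
          then have "w \<in> Box" using w(3,4) unfolding Box_def by (auto simp: PiE_iff split: if_splits)
          then have "w k \<in> \<Union>\<G>" using w by (auto simp: \<G>_def)
          moreover have "w k \<in> V" using bspec[OF w(3) k] by simp
          ultimately show False using UV(5) by (meson DiffD2 subsetD)
        qed
        then obtain F w where w: "F \<in> \<F>" "w \<in> F" "w \<in> Box" "w k = z k" unfolding \<G>_def by auto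
        have zN: "z i \<in> N i" if "i \<in> I" for i using insert.prems(2)[OF that] by blast
        have coord: "w i \<in> (if i \<in> J then {z i} else if i = k then topspace X else N i)" if "i \<in> I" for i
          using w(3) that unfolding Box_def by (rule PiE_mem)
        have "w i \<in> N i" if "i \<in> I" for i
        proof (cases "i \<in> insert k J")
          case True
          then have "w i = z i" using coord[OF that] w(4) by (cases "i \<in> J") auto
          then show ?thesis using zN[OF that] by simp
        next
          case False
          then show ?thesis using coord[OF that] by simp
        qed
        moreover have "w i = z i" if "i \<in> insert k J" for i
          using coord[of i] w(4) that insert.prems(1) by (cases "i \<in> J") auto
        ultimately show ?case using w(1,2) by (intro bexI[of _ w]) auto
      qed
      have "\<exists>w\<in>\<Union>\<F>. (\<forall>i\<in>I. w i \<in> topspace X) \<and> (\<forall>i\<in>I. w i = z i)"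
        using zY by (intro approx[OF I]) (auto simp: PiE_iff)
      then obtain w where w: "w \<in> \<Union>\<F>" "\<forall>i\<in>I. w i = z i" by blast
      then have "w \<in> PiE I (\<lambda>_. topspace X)" using E by auto
      then have "w = z" using zY w(2) by (auto intro: PiE_ext)
      with w show "z \<in> \<Union>\<F>" by blast
    qed
  qed
qed

text \<open>
  The closures of the initial segments form a countably directed family, so their union is
  closed.  By compactness it contains a point \<open>z\<close> outside every \<open>V q\<close>, since each finite
  set of indices \<open>q\<close> has an upper bound.  But \<open>z\<close> lies in the closure of some initial segment,
  and hence in some \<open>K q \<subseteq> V q\<close>.
\<close>

lemma no_long_free_sequence:
  fixes y :: "'b \<Rightarrow> 'a" and less :: "'b \<Rightarrow> 'b \<Rightarrow> bool" (infix "\<sqsubset>" 50)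
  assumes compact: "compact_space Y" and tight: "countably_tight Y"
    and trans: "\<And>p q s. \<lbrakk>p \<in> B; q \<in> B; s \<in> B; p \<sqsubset> q; q \<sqsubset> s\<rbrakk> \<Longrightarrow> p \<sqsubset> s"
    and bounded: "\<And>C. \<lbrakk>C \<subseteq> B; countable C\<rbrakk> \<Longrightarrow> \<exists>q\<in>B. \<forall>p\<in>C. p \<sqsubset> q"
    and K: "\<And>q. q \<in> B \<Longrightarrow> closedin Y (K q)" and V: "\<And>q. q \<in> B \<Longrightarrow> openin Y (V q)"
    and KV: "\<And>q. q \<in> B \<Longrightarrow> K q \<subseteq> V q"
    and before: "\<And>p q. \<lbrakk>p \<in> B; q \<in> B; p \<sqsubset> q\<rbrakk> \<Longrightarrow> y p \<in> K q"
    and after: "\<And>p q. \<lbrakk>p \<in> B; q \<in> B; q \<sqsubset> p\<rbrakk> \<Longrightarrow> y p \<notin> V q"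
  shows False
proof -
  define F where "F q = Y closure_of (y ` {p \<in> B. p \<sqsubset> q})" for q
  have yF: "y p \<in> F q" if pq: "p \<in> B" "q \<in> B" "p \<sqsubset> q" for p q
    unfolding F_def
  proof (rule subsetD[OF closure_of_subset])
    show "y ` {p \<in> B. p \<sqsubset> q} \<subseteq> topspace Y"
      using before[OF _ pq(2)] closedin_subset[OF K[OF pq(2)]] by auto
  qed (use pq in auto)
  have "countably_directed (F ` B)"
    unfolding countably_directed_def
  proof (intro allI impI)
    fix \<C> assume "\<C> \<subseteq> F ` B" "countable \<C>"
    then obtain C where C: "C \<subseteq> B" "countable C" "\<C> = F ` C"
      by (meson countable_subset_image)
    then obtain q where q: "q \<in> B" "\<forall>p\<in>C. p \<sqsubset> q" using bounded by blast
    have "F p \<subseteq> F q" if "p \<in> C" for p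
      unfolding F_def using that C(1) q trans by (intro closure_of_mono image_mono) blast
    then have "\<Union>\<C> \<subseteq> F q" using C(3) by (simp add: UN_subset_iff)
    with q(1) show "\<exists>F\<in>F ` B. \<Union>\<C> \<subseteq> F" by (intro bexI[of _ "F q"]) auto
  qed
  then have E: "closedin Y (\<Union>(F ` B))"
    by (intro countably_tightD[OF tight]) (auto simp: F_def)
  have "\<exists>z\<in>\<Union>(F ` B). \<forall>q\<in>B. z \<in> topspace Y - V q"
  proof (rule compact_space_closed_family_meets[OF compact E])
    show "closedin Y (topspace Y - V q)" if "q \<in> B" for q using V[OF that] by blast
    fix C assume C: "finite C" "C \<subseteq> B"
    obtain p where p: "p \<in> B" "\<forall>q\<in>C. q \<sqsubset> p" using bounded[OF C(2) countable_finite[OF C(1)]] by metis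
    obtain s where s: "s \<in> B" "p \<sqsubset> s" using bounded[of "{p}"] p by auto
    have "y p \<in> topspace Y" using before[OF p(1) s] closedin_subset[OF K[OF s(1)]] by auto
    moreover have "y p \<notin> V q" if "q \<in> C" for q using after[OF p(1)] p(2) C(2) that by blast
    moreover have "y p \<in> \<Union>(F ` B)" using yF[OF p(1) s] s(1) by (rule UN_I[rotated])
    ultimately show "\<exists>z\<in>\<Union>(F ` B). \<forall>q\<in>C. z \<in> topspace Y - V q"
      by (intro bexI[of _ "y p"]) auto
  qed
  then obtain z q where z: "q \<in> B" "z \<in> F q" "\<forall>q\<in>B. z \<notin> V q" by auto
  have "F q \<subseteq> K q"
    unfolding F_def using before[OF _ z(1)] by (intro closure_of_minimal K z) auto
  with z(2,3) KV[OF z(1)] z(1) show False by auto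
qed

section \<open>Martin's axiom for finite cliques\<close>

lemma countable_Union_finite:
  assumes "countable C" "\<And>p. p \<in> C \<Longrightarrow> finite p"
  shows "countable (\<Union>C)"
  using countable_UN[of C "\<lambda>p. p"] assms countable_finite by auto

definition finite_cliques :: "'i set \<Rightarrow> ('i \<Rightarrow> 'i \<Rightarrow> bool) \<Rightarrow> 'i set set" where
  "finite_cliques I Q = {p. finite p \<and> p \<subseteq> I \<and> pairwise Q p}"

definition extends_on :: "'i set set \<Rightarrow> 'i set rel" where
  "extends_on P = {(p, q). p \<in> P \<and> q \<in> P \<and> q \<subseteq> p}"

lemma partial_order_extends_on: "partial_order_on P (extends_on P)"
  by (auto simp: partial_order_on_def preorder_on_def refl_on_def trans_def antisym_def extends_on_def)

lemma finite_cliques_subset: "\<lbrakk>p \<in> finite_cliques I Q; q \<subseteq> p\<rbrakk> \<Longrightarrow> q \<in> finite_cliques I Q"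
  unfolding finite_cliques_def using finite_subset pairwise_subset by blast

text \<open>
  Stated for the conditions above a fixed \<open>t\<close>, because the forcing argument has to pass to such
  a cone.
\<close>

lemma compatible_finite_cliques_above:
  assumes "p \<in> finite_cliques I Q" "q \<in> finite_cliques I Q" "t \<subseteq> p"
  shows "forcing_compatible {s \<in> finite_cliques I Q. t \<subseteq> s} (extends_on {s \<in> finite_cliques I Q. t \<subseteq> s}) p q
     \<longleftrightarrow> t \<subseteq> q \<and> p \<union> q \<in> finite_cliques I Q"
    (is "?L \<longleftrightarrow> ?R")
proof
  assume ?L
  then obtain s where "s \<in> finite_cliques I Q" "p \<union> q \<subseteq> s" "t \<subseteq> q"
    unfolding forcing_compatible_def extends_on_def by auto
  then show ?R using finite_cliques_subset by metis
next
  assume ?R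
  then show ?L using assms unfolding forcing_compatible_def extends_on_def
    by (intro bexI[of _ "p \<union> q"]) auto
qed

lemma compatible_finite_cliques:
  assumes "p \<in> finite_cliques I Q" "q \<in> finite_cliques I Q"
  shows "forcing_compatible (finite_cliques I Q) (extends_on (finite_cliques I Q)) p q
     \<longleftrightarrow> p \<union> q \<in> finite_cliques I Q"
  using compatible_finite_cliques_above[OF assms, of "{}"] by simp

text \<open>
  The order of \<open>\<omega>\<^sub>1\<close> on a set \<open>I\<close>, given by its strict initial segments \<open>seg a = {b. b < a}\<close>.
\<close>

locale omega1_order =
  fixes I :: "'i set" and seg :: "'i \<Rightarrow> 'i set"
  assumes wf_seg: "wf {(a, b). a \<in> seg b}"
    and countable_seg: "countable (seg a)"
    and seg_linear: "\<lbrakk>a \<in> I; b \<in> I\<rbrakk> \<Longrightarrow> a \<in> seg b \<or> a = b \<or> b \<in> seg a"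
    and seg_trans: "\<lbrakk>a \<in> seg b; b \<in> seg c\<rbrakk> \<Longrightarrow> a \<in> seg c"
    and uncountable_I: "uncountable I"
    and card_I: "(card_of I, cardSuc natLeq) \<in> ordLeq"
begin

lemma seg_bounded:
  assumes "C \<subseteq> I" "countable C"
  obtains c where "c \<in> I" "C \<subseteq> seg c"
proof -
  have "countable (\<Union>a\<in>C. insert a (seg a))" using assms countable_seg by blast
  then obtain c where "c \<in> I" "c \<notin> (\<Union>a\<in>C. insert a (seg a))"
    using uncountable_I by (meson countable_subset subsetI)
  then show thesis using that assms seg_linear by blast
qed

lemma seg_irrefl: "a \<notin> seg a"
  using wf_seg wf_not_refl by fastforce

text \<open>
  The union of a filter of finite cliques is a clique.  To make it uncountable, the filter
  must contain conditions reaching beyond each \<open>a \<in> I\<close>.  These are dense below a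
  condition \<open>p\<close> all of whose extensions \<open>q\<close> have uncountably many one-point extensions.
  Such a \<open>p\<close> exists: otherwise the conditions with only countably many one-point extensions
  are dense, and a maximal antichain of them, being countable, involves only countably many
  indices; any other index then gives a condition incompatible with the whole antichain.
\<close>

lemma uncountable_clique_if_ccc:
  includes cardinal_syntax
  assumes MA: "MA_omega1 TYPE('i set)"
    and ccc: "forcing_ccc (finite_cliques I Q) (extends_on (finite_cliques I Q))"
  shows "\<exists>C\<subseteq>I. uncountable C \<and> pairwise Q C"
proof -
  define P where "P = finite_cliques I Q"
  define ext where "ext p = {a \<in> I. insert a p \<in> P}" for p
  have singleton: "{a} \<in> P" if "a \<in> I" for a using that by (auto simp: P_def finite_cliques_def)
  have "\<exists>p\<in>P. \<forall>q\<in>P. p \<subseteq> q \<longrightarrow> uncountable (ext q)"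
  proof (rule ccontr)
    assume "\<not> ?thesis"
    then have small: "\<exists>q\<in>P. p \<subseteq> q \<and> countable (ext q)" if "p \<in> P" for p using that by blast
    define Bad where "Bad = {q \<in> P. countable (ext q)}"
    have "\<not> (\<exists>A\<subseteq>Bad. uncountable A \<and> pairwise (\<lambda>p q. p \<union> q \<notin> P) A)"
    proof
      assume "\<exists>A\<subseteq>Bad. uncountable A \<and> pairwise (\<lambda>p q. p \<union> q \<notin> P) A"
      then obtain A where sub: "A \<subseteq> Bad" and A: "uncountable A" "pairwise (\<lambda>p q. p \<union> q \<notin> P) A"
        by metis
      have "A \<subseteq> P" using sub by (auto simp: Bad_def)
      with A have "pairwise (\<lambda>p q. \<not> forcing_compatible P (extends_on P) p q) A"
        unfolding P_def pairwise_def by (meson compatible_finite_cliques subsetD)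
      then show False using A(1) \<open>A \<subseteq> P\<close> ccc unfolding P_def[symmetric] forcing_ccc_def by simp
    qed
    then have "\<exists>A\<subseteq>Bad. countable A \<and> (\<forall>q\<in>Bad - A. \<exists>p\<in>A. p \<union> q \<in> P)"
    proof (rule contrapos_np)
      assume no: "\<not> ?thesis"
      show "\<exists>A\<subseteq>Bad. uncountable A \<and> pairwise (\<lambda>p q. p \<union> q \<notin> P) A"
      proof (rule uncountable_pairwise)
        fix A assume "A \<subseteq> Bad" "countable A"
        with no have "\<exists>q\<in>Bad - A. \<forall>p\<in>A. p \<union> q \<notin> P" by metis
        then show "\<exists>q\<in>Bad - A. \<forall>p\<in>A. p \<union> q \<notin> P \<and> q \<union> p \<notin> P" by (simp add: Un_commute)
      qed
    qed
    then obtain A where A: "A \<subseteq> Bad" "countable A"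
      and maximal: "\<And>q. q \<in> Bad - A \<Longrightarrow> \<exists>p\<in>A. p \<union> q \<in> P" by metis
    have "countable (\<Union>A)"
      by (rule countable_Union_finite[OF A(2)]) (use A(1) in \<open>auto simp: Bad_def P_def finite_cliques_def\<close>)
    moreover have "countable (\<Union>p\<in>A. ext p)" using A by (intro countable_UN) (auto simp: Bad_def)
    ultimately have "countable (\<Union>A \<union> (\<Union>p\<in>A. ext p))" by (rule countable_Un)
    then obtain a where a: "a \<in> I" "a \<notin> \<Union>A" "a \<notin> (\<Union>p\<in>A. ext p)"
      using uncountable_I by (meson countable_subset subsetI UnI1 UnI2)
    obtain q where q: "q \<in> Bad" "a \<in> q" using small[OF singleton[OF a(1)]] by (auto simp: Bad_def)
    then obtain p where p: "p \<in> A" "p \<union> q \<in> P" using maximal a(2) by blast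
    have "insert a p \<subseteq> p \<union> q" using q by blast
    then have "insert a p \<in> P" using p finite_cliques_subset unfolding P_def by blast
    then show False using a p by (auto simp: ext_def)
  qed
  then obtain p where p: "p \<in> P" and big: "\<And>q. q \<in> P \<Longrightarrow> p \<subseteq> q \<Longrightarrow> uncountable (ext q)" by blast
  define P' where "P' = {q \<in> P. p \<subseteq> q}"
  define D where "D a = {q \<in> P'. \<not> q \<subseteq> seg a}" for a
  have "forcing_ccc P' (extends_on P')"
    unfolding forcing_ccc_def
  proof (intro allI impI)
    fix A assume A: "A \<subseteq> P'" "pairwise (\<lambda>p q. \<not> forcing_compatible P' (extends_on P') p q) A"
    have "pairwise (\<lambda>p q. \<not> forcing_compatible P (extends_on P) p q) A"
      unfolding pairwise_def
    proof (intro ballI impI)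
      fix q s assume qs: "q \<in> A" "s \<in> A" "q \<noteq> s"
      then have "q \<in> P" "s \<in> P" "p \<subseteq> q" "p \<subseteq> s" using A(1) by (auto simp: P'_def)
      moreover have "\<not> forcing_compatible P' (extends_on P') q s"
        using A(2) qs by (simp add: pairwise_def)
      ultimately show "\<not> forcing_compatible P (extends_on P) q s"
        unfolding P'_def P_def by (simp add: compatible_finite_cliques compatible_finite_cliques_above)
    qed
    moreover have "A \<subseteq> P" using A(1) by (auto simp: P'_def)
    ultimately show "countable A" using ccc unfolding forcing_ccc_def P_def[symmetric] by blast
  qed
  moreover have "\<forall>E\<in>D ` I. forcing_dense P' (extends_on P') E"
  proof
    fix E assume "E \<in> D ` I"
    then obtain a where a: "E = D a" by blast
    show "forcing_dense P' (extends_on P') E"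
      unfolding forcing_dense_def
    proof (intro conjI ballI)
      show "E \<subseteq> P'" by (auto simp: a D_def)
      fix q assume q: "q \<in> P'"
      then have "uncountable (ext q)" using big by (auto simp: P'_def)
      then obtain b where b: "b \<in> ext q" "b \<notin> seg a"
        using countable_seg by (meson countable_subset subsetI)
      then have "insert b q \<in> P'" using q by (auto simp: P'_def ext_def)
      then show "\<exists>d\<in>E. (d, q) \<in> extends_on P'"
        using b q by (intro bexI[of _ "insert b q"]) (auto simp: a D_def extends_on_def)
    qed
  qed
  moreover have "|D ` I| \<le>o cardSuc natLeq"
    by (rule ordLeq_transitive[OF card_of_image card_I])
  moreover have "P' \<noteq> {}" using p by (auto simp: P'_def)
  ultimately obtain G where G: "forcing_filter P' (extends_on P') G" "\<forall>E\<in>D ` I. G \<inter> E \<noteq> {}"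
    using MA[unfolded MA_omega1_def, rule_format, of P' "extends_on P'" "D ` I"]
      partial_order_extends_on by blast
  have GP: "G \<subseteq> P" using G(1) by (auto simp: forcing_filter_def P'_def)
  have sub: "\<Union>G \<subseteq> I" using GP by (auto simp: P_def finite_cliques_def)
  have "pairwise Q (\<Union>G)"
    unfolding pairwise_def
  proof (intro ballI impI)
    fix a b assume ab: "a \<in> \<Union>G" "b \<in> \<Union>G" "a \<noteq> b"
    then obtain p q where pq: "p \<in> G" "q \<in> G" "a \<in> p" "b \<in> q" by blast
    then obtain s where s: "s \<in> G" "(s, p) \<in> extends_on P'" "(s, q) \<in> extends_on P'"
      using G(1) unfolding forcing_filter_def by metis
    then have "a \<in> s" "b \<in> s" using pq(3,4) by (auto simp: extends_on_def)
    with s(1) show "Q a b" using GP ab(3) by (auto simp: P_def finite_cliques_def pairwise_def)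
  qed
  moreover have "uncountable (\<Union>G)"
  proof
    assume "countable (\<Union>G)"
    then obtain c where "c \<in> I" "\<Union>G \<subseteq> seg c" using seg_bounded[OF sub] by metis
    moreover obtain q where "q \<in> G" "q \<in> D c" using G(2) \<open>c \<in> I\<close> by blast
    ultimately show False by (auto simp: D_def)
  qed
  ultimately show ?thesis using sub by blast
qed

definition block_less :: "'i set \<Rightarrow> 'i set \<Rightarrow> bool" where
  "block_less p q \<longleftrightarrow> (\<forall>a\<in>p. \<forall>b\<in>q. a \<in> seg b)"

text \<open>
  If there is no uncountable clique, the finite cliques are not ccc.  Choose an uncountable
  antichain of cliques of the same size \<open>n\<close>, with \<open>n\<close> minimal.  Then no index belongs to
  uncountably many members: removing a common index from two cliques keeps them
  incompatible, so this would give a smaller \<open>n\<close>.  This does the work of the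
  delta system lemma; since each member then overlaps only countably many others, an
  uncountable subfamily consists of blocks placed one after another.
\<close>

lemma uncountable_clique_or_incompatible_blocks:
  assumes MA: "MA_omega1 TYPE('i set)"
    and no_clique: "\<not> (\<exists>C\<subseteq>I. uncountable C \<and> pairwise Q C)"
  obtains n B where "\<And>p. p \<in> B \<Longrightarrow> finite p \<and> p \<subseteq> I \<and> p \<noteq> {} \<and> card p = n"
    and "\<And>C. C \<subseteq> B \<Longrightarrow> countable C \<Longrightarrow> \<exists>q\<in>B. \<forall>p\<in>C. block_less p q"
    and "\<And>p q. \<lbrakk>p \<in> B; q \<in> B; block_less p q\<rbrakk> \<Longrightarrow> \<exists>a\<in>p. \<exists>b\<in>q. \<not> Q a b \<or> \<not> Q b a"
proof -
  let ?P = "finite_cliques I Q"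
  let ?inc = "pairwise (\<lambda>p q. p \<union> q \<notin> ?P)"
  have "\<not> forcing_ccc ?P (extends_on ?P)" using uncountable_clique_if_ccc[OF MA] no_clique by blast
  then obtain A where A: "A \<subseteq> ?P" "uncountable A"
    and "pairwise (\<lambda>p q. \<not> forcing_compatible ?P (extends_on ?P) p q) A"
    unfolding forcing_ccc_def by blast
  then have A_inc: "?inc A"
    unfolding pairwise_def by (meson compatible_finite_cliques subsetD)
  define large where "large n \<longleftrightarrow> (\<exists>A\<subseteq>?P. uncountable A \<and> (\<forall>p\<in>A. card p = n) \<and> ?inc A)" for n
  have "\<exists>n. large n"
  proof (rule ccontr)
    assume none: "\<nexists>n. large n"
    have "countable {p \<in> A. card p = n}" for n
      using none[unfolded large_def, simplified, rule_format, of "{p \<in> A. card p = n}" n]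
        A(1) pairwise_subset[OF A_inc, of "{p \<in> A. card p = n}"] by auto
    then have "countable (\<Union>n. {p \<in> A. card p = n})" by blast
    moreover have "(\<Union>n. {p \<in> A. card p = n}) = A" by auto
    ultimately show False using A by simp
  qed
  define n where "n = (LEAST n. large n)"
  have "large n" using \<open>\<exists>n. large n\<close> unfolding n_def by (rule LeastI_ex)
  then obtain A where A: "A \<subseteq> ?P" "uncountable A" "\<forall>p\<in>A. card p = n" "?inc A"
    unfolding large_def by blast
  have finA: "finite p" "p \<subseteq> I" "pairwise Q p" if "p \<in> A" for p
    using that A(1) by (auto simp: finite_cliques_def)
  have "n \<noteq> 0"
  proof
    assume "n = 0"
    then have "A \<subseteq> {{}}" using A(3) finA by auto
    then show False using A(2) by (meson countable_empty countable_insert countable_subset)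
  qed
  have star: "countable {p \<in> A. a \<in> p}" for a
  proof (rule ccontr)
    assume unc: "uncountable {p \<in> A. a \<in> p}"
    let ?f = "\<lambda>p. p - {a}"
    have "inj_on ?f {p \<in> A. a \<in> p}" by (auto intro!: inj_onI)
    then have "uncountable (?f ` {p \<in> A. a \<in> p})" using unc countable_image_inj_on by blast
    moreover have "?f ` {p \<in> A. a \<in> p} \<subseteq> ?P" using A(1) finite_cliques_subset by blast
    moreover have "\<forall>p\<in>?f ` {p \<in> A. a \<in> p}. card p = n - 1" using A(3) finA by auto
    moreover have "?inc (?f ` {p \<in> A. a \<in> p})"
      unfolding pairwise_def
    proof (intro ballI impI notI)
      fix p' q' assume "p' \<in> ?f ` {p \<in> A. a \<in> p}" "q' \<in> ?f ` {p \<in> A. a \<in> p}" "p' \<noteq> q'"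
        and mem: "p' \<union> q' \<in> ?P"
      then obtain p q where pq: "p \<in> A" "q \<in> A" "a \<in> p" "a \<in> q" "p' = p - {a}" "q' = q - {a}" "p \<noteq> q"
        by blast
      have "Q c d" if "c \<in> p \<union> q" "d \<in> p \<union> q" "c \<noteq> d" for c d
      proof (cases "c = a \<or> d = a")
        case True
        then have "c \<in> p \<and> d \<in> p \<or> c \<in> q \<and> d \<in> q" using that pq by blast
        then show ?thesis using finA(3) pq(1,2) that(3) by (auto simp: pairwise_def)
      next
        case False
        then show ?thesis using that mem pq by (auto simp: finite_cliques_def pairwise_def)
      qed
      then have "p \<union> q \<in> ?P" using finA pq by (auto simp: finite_cliques_def pairwise_def)
      then show False using A(4) pq by (auto simp: pairwise_def)
    qed
    ultimately have "large (n - 1)" unfolding large_def by blast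
    moreover have "n - 1 < n" using \<open>n \<noteq> 0\<close> by simp
    ultimately show False unfolding n_def using not_less_Least by blast
  qed
  have "\<exists>B\<subseteq>A. uncountable B \<and> pairwise (\<lambda>p q. block_less p q \<or> block_less q p) B"
  proof (rule uncountable_pairwise)
    fix C assume C: "C \<subseteq> A" "countable C"
    have "countable (\<Union>C)" by (rule countable_Union_finite[OF C(2)]) (use C(1) finA in blast)
    moreover have "\<Union>C \<subseteq> I" using C finA by blast
    ultimately obtain c where c: "c \<in> I" "\<Union>C \<subseteq> seg c" using seg_bounded[of "\<Union>C"] by metis
    have "countable (C \<union> (\<Union>a\<in>insert c (seg c). {p \<in> A. a \<in> p}))"
      using C countable_seg star by (intro countable_Un countable_UN) auto
    then have "\<not> A \<subseteq> C \<union> (\<Union>a\<in>insert c (seg c). {p \<in> A. a \<in> p})"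
      using A(2) countable_subset by metis
    then obtain q where "q \<in> A" "q \<notin> C \<union> (\<Union>a\<in>insert c (seg c). {p \<in> A. a \<in> p})"
      by (meson subsetI)
    then have q: "q \<in> A" "q \<notin> C" "q \<inter> insert c (seg c) = {}" by auto
    have "block_less p q" if "p \<in> C" for p
      unfolding block_less_def
    proof (intro ballI)
      fix a b assume ab: "a \<in> p" "b \<in> q"
      then have "c \<in> seg b" using seg_linear[OF c(1), of b] q finA by blast
      moreover have "a \<in> seg c" using c ab that by blast
      ultimately show "a \<in> seg b" using seg_trans by blast
    qed
    then show "\<exists>q\<in>A - C. \<forall>p\<in>C. (block_less p q \<or> block_less q p) \<and> (block_less q p \<or> block_less p q)"
      using q by blast
  qed
  then obtain B where B: "B \<subseteq> A" "uncountable B" "pairwise (\<lambda>p q. block_less p q \<or> block_less q p) B"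
    by blast
  show thesis
  proof (rule that[of B n])
    show elem: "finite p \<and> p \<subseteq> I \<and> p \<noteq> {} \<and> card p = n" if "p \<in> B" for p
    proof -
      have "p \<in> A" using that B(1) by blast
      then show ?thesis using A(3) finA[of p] \<open>n \<noteq> 0\<close> by auto
    qed
    show "\<exists>q\<in>B. \<forall>p\<in>C. block_less p q" if C: "C \<subseteq> B" "countable C" for C
    proof -
      have "countable (\<Union>C)" by (rule countable_Union_finite[OF C(2)]) (use C(1) elem in blast)
      moreover have "\<Union>C \<subseteq> I" using C elem by blast
      ultimately obtain c where c: "c \<in> I" "\<Union>C \<subseteq> seg c" using seg_bounded[of "\<Union>C"] by metis
      have "countable {q. finite q \<and> q \<subseteq> seg c}"
        using countable_seg by (rule countable_Collect_finite_subset)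
      then have "\<not> B \<subseteq> {q. finite q \<and> q \<subseteq> seg c}" using B(2) countable_subset by metis
      then obtain q where q: "q \<in> B" "\<not> q \<subseteq> seg c" using elem by auto
      have "block_less p q" if p: "p \<in> C" for p
      proof (rule ccontr)
        assume "\<not> block_less p q"
        moreover have "p \<noteq> q" using q c p by blast
        ultimately have "block_less q p" using B(3) q p C(1) by (auto simp: pairwise_def)
        moreover obtain b where "b \<in> p" using elem C p by blast
        ultimately have "q \<subseteq> seg c" using c p seg_trans unfolding block_less_def by blast
        with q show False by blast
      qed
      with q show ?thesis by blast
    qed
    show "\<exists>a\<in>p. \<exists>b\<in>q. \<not> Q a b \<or> \<not> Q b a" if pq: "p \<in> B" "q \<in> B" "block_less p q" for p q
    proof (rule ccontr)
      assume no: "\<not> ?thesis"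
      have "p \<noteq> q" using pq elem seg_irrefl unfolding block_less_def by blast
      then have "p \<union> q \<notin> ?P" using A(4) pq B(1) by (auto simp: pairwise_def)
      moreover have "p \<union> q \<in> ?P"
      proof -
        have pqA: "p \<in> A" "q \<in> A" using pq B(1) by auto
        have "Q c d" if "c \<in> p \<union> q" "d \<in> p \<union> q" "c \<noteq> d" for c d
          using that no finA(3)[OF pqA(1)] finA(3)[OF pqA(2)] unfolding pairwise_def by fast
        then show ?thesis
          using finA(1,2)[OF pqA(1)] finA(1,2)[OF pqA(2)] by (simp add: finite_cliques_def pairwise_def)
      qed
      ultimately show False by simp
    qed
  qed
qed

end

lemma omega1_order_exists:
  includes cardinal_syntax
  shows "\<exists>(I :: nat set set) seg. omega1_order I seg"
proof -
  let ?r = "cardSuc natLeq"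
  have card: "Card_order ?r" by (rule cardSuc_Card_order[OF natLeq_Card_order])
  then have wo: "Well_order ?r" by (simp add: card_order_on_def)
  have "omega1_order (Field ?r) (underS ?r)"
  proof
    have "{(a, b). a \<in> underS ?r b} = ?r - Id" by (auto simp: underS_def)
    then show "wf {(a, b). a \<in> underS ?r b}" using wo by (simp add: well_order_on_def)
    show "countable (underS ?r a)" for a
    proof (cases "a \<in> Field ?r")
      case True
      have "|underS ?r a| \<le>o natLeq"
        using card_of_underS[OF card True] cardSuc_ordLeq_ordLess[OF natLeq_Card_order card_of_Card_order]
        by blast
      then show ?thesis by (simp add: countable_card_le_natLeq)
    qed (simp add: underS_empty)
    show "a \<in> underS ?r b \<or> a = b \<or> b \<in> underS ?r a" if "a \<in> Field ?r" "b \<in> Field ?r" for a b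
      using wo that unfolding well_order_on_def linear_order_on_def total_on_def underS_def by blast
    show "a \<in> underS ?r c" if "a \<in> underS ?r b" "b \<in> underS ?r c" for a b c
      using wo that unfolding well_order_on_def linear_order_on_def partial_order_on_def
        preorder_on_def underS_def by (blast dest: transD antisymD)
    have eq: "|Field ?r| =o ?r" by (rule card_of_Field_ordIso[OF card])
    show "|Field ?r| \<le>o ?r" using eq by (rule ordIso_imp_ordLeq)
    show "uncountable (Field ?r)"
    proof
      assume "countable (Field ?r)"
      then have "|Field ?r| \<le>o natLeq" by (simp add: countable_card_le_natLeq)
      then have "?r \<le>o natLeq" using eq ordIso_symmetric ordIso_ordLeq_trans by blast
      then show False using cardSuc_greater[OF natLeq_Card_order] not_ordLess_ordLeq by blast
    qed
  qed
  then show ?thesis by blast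
qed

section \<open>Hereditary Lindelofness under Martin's axiom\<close>

text \<open>
  Szentmiklossy's theorem.  If no countable subfamily has the full union, the points \<open>x a\<close>
  and the sets \<open>V a \<in> \<V>\<close> are found by recursion along \<open>\<omega>\<^sub>1\<close>.  The closed set \<open>K a\<close> between
  \<open>U a\<close> and \<open>V a\<close> is what turns the conflicts within an antichain into a free sequence: a
  conflict only puts a point of an earlier block into some \<open>U b\<close>, and the closure of the
  earlier tuples still stays inside the open set given by the sets \<open>V b\<close>.
\<close>

theorem MA_hereditarily_Lindelof:
  assumes MA: "MA_omega1 TYPE(nat set)"
    and compact: "compact_space X" and Haus: "Hausdorff_space X" and spread: "countable_spread X"
    and opens: "\<And>V. V \<in> \<V> \<Longrightarrow> openin X V"
  shows "\<exists>\<U>\<subseteq>\<V>. countable \<U> \<and> \<Union>\<U> = \<Union>\<V>"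
proof (rule ccontr)
  assume no: "\<not> ?thesis"
  obtain I :: "nat set set" and seg where "omega1_order I seg" using omega1_order_exists by blast
  then interpret omega1_order I seg .
  have "\<exists>f. \<forall>a. snd (f a) \<in> \<V> \<and> fst (f a) \<in> snd (f a) \<and> (\<forall>b\<in>seg a. fst (f a) \<notin> snd (f b))"
  proof (rule dependent_wf_choice[OF wf_seg])
    fix f :: "nat set \<Rightarrow> 'a \<times> 'a set" and a
    assume IH: "\<And>b. (b, a) \<in> {(a, b). a \<in> seg b} \<Longrightarrow>
      snd (f b) \<in> \<V> \<and> fst (f b) \<in> snd (f b) \<and> (\<forall>c\<in>seg b. fst (f b) \<notin> snd (f c))"
    have "(\<lambda>b. snd (f b)) ` seg a \<subseteq> \<V>" using IH by auto
    moreover have "countable ((\<lambda>b. snd (f b)) ` seg a)" using countable_seg by blast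
    ultimately have "\<Union>((\<lambda>b. snd (f b)) ` seg a) \<noteq> \<Union>\<V>" "\<Union>((\<lambda>b. snd (f b)) ` seg a) \<subseteq> \<Union>\<V>"
      using no by blast+
    then obtain x V where "x \<notin> \<Union>((\<lambda>b. snd (f b)) ` seg a)" "x \<in> V" "V \<in> \<V>" by blast
    then show "\<exists>r. snd r \<in> \<V> \<and> fst r \<in> snd r \<and> (\<forall>b\<in>seg a. fst r \<notin> snd (f b))"
      by (intro exI[of _ "(x, V)"]) auto
  qed auto
  then obtain f where f: "\<And>a. snd (f a) \<in> \<V>" "\<And>a. fst (f a) \<in> snd (f a)"
      "\<And>a b. b \<in> seg a \<Longrightarrow> fst (f a) \<notin> snd (f b)"
    by blast
  define x where "x a = fst (f a)" for a
  define V where "V a = snd (f a)" for a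
  have V: "openin X (V a)" "x a \<in> V a" for a using f opens by (auto simp: x_def V_def)
  have later: "x a \<notin> V b" if "b \<in> seg a" for a b using f that by (auto simp: x_def V_def)
  have "\<forall>a. \<exists>U K. openin X U \<and> closedin X K \<and> x a \<in> U \<and> U \<subseteq> K \<and> K \<subseteq> V a"
    using regular_space_closed_neighbourhood[OF compact_Hausdorff_imp_regular_space[OF compact Haus] V] by metis
  then obtain U K where U: "\<And>a. openin X (U a)" "\<And>a. x a \<in> U a"
    and K: "\<And>a. closedin X (K a)" "\<And>a. U a \<subseteq> K a" "\<And>a. K a \<subseteq> V a"
    by metis
  \<comment> \<open>Only one half of this can fail for \<open>a < b\<close>, namely \<open>x a \<notin> U b\<close>; the symmetric form
  makes a clique a discrete family.\<close>
  define Q where "Q a b \<longleftrightarrow> x a \<notin> U b \<and> x b \<notin> U a" for a b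
  have no_clique: "\<not> (\<exists>C\<subseteq>I. uncountable C \<and> pairwise Q C)"
  proof
    assume "\<exists>C\<subseteq>I. uncountable C \<and> pairwise Q C"
    then obtain C where C: "uncountable C" "pairwise Q C" by blast
    have "countable C"
    proof (rule countable_spread_isolated[OF spread, where f = x])
      fix a assume "a \<in> C"
      then have "\<forall>b\<in>C. b \<noteq> a \<longrightarrow> x b \<notin> U a" using C(2) by (auto simp: pairwise_def Q_def)
      then show "\<exists>W. openin X W \<and> x a \<in> W \<and> (\<forall>b\<in>C. b \<noteq> a \<longrightarrow> x b \<notin> W)" using U by blast
    qed
    with C(1) show False by simp
  qed
  obtain n B where elem: "\<And>p. p \<in> B \<Longrightarrow> finite p \<and> p \<subseteq> I \<and> p \<noteq> {} \<and> card p = n"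
    and bounded: "\<And>C. C \<subseteq> B \<Longrightarrow> countable C \<Longrightarrow> \<exists>q\<in>B. \<forall>p\<in>C. block_less p q"
    and conflict: "\<And>p q. \<lbrakk>p \<in> B; q \<in> B; block_less p q\<rbrakk> \<Longrightarrow> \<exists>a\<in>p. \<exists>b\<in>q. \<not> Q a b \<or> \<not> Q b a"
    by (rule uncountable_clique_or_incompatible_blocks[OF MA_omega1_any_type[OF MA] no_clique]) (rule that)
  have "\<exists>e. bij_betw e {..<n} p" if "p \<in> B" for p
    using elem[OF that] ex_bij_betw_nat_finite[of p] by (auto simp: atLeast0LessThan)
  then obtain e where e: "\<And>p. p \<in> B \<Longrightarrow> bij_betw (e p) {..<n} p" by metis
  \<comment> \<open>The block \<open>p\<close> becomes the \<open>n\<close>-tuple of its points, in an arbitrary enumeration.\<close>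
  define y where "y p = restrict (\<lambda>i. x (e p i)) {..<n}" for p
  have y: "(\<exists>i\<in>{..<n}. y p i \<in> S) \<longleftrightarrow> (\<exists>a\<in>p. x a \<in> S)" if "p \<in> B" for p S
  proof -
    have "(\<exists>a\<in>e p ` {..<n}. x a \<in> S) \<longleftrightarrow> (\<exists>i\<in>{..<n}. y p i \<in> S)" by (simp add: y_def)
    moreover have "e p ` {..<n} = p" using e[OF that] by (rule bij_betw_imp_surj_on)
    ultimately show ?thesis by simp
  qed
  let ?Y = "product_topology (\<lambda>_. X) {..<n}"
  have coordinate: "continuous_map ?Y X (\<lambda>w. w i)" if "i \<in> {..<n}" for i
    using that by (rule continuous_map_product_projection)
  \<comment> \<open>A tuple hits \<open>S\<close> if one of its coordinates is in \<open>S\<close>.  A conflict between \<open>p\<close> and a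
  later block \<open>q\<close> says that \<open>y p\<close> hits the union of the sets \<open>U b\<close> for \<open>b \<in> q\<close>.\<close>
  define hit where "hit S = (\<Union>i\<in>{..<n}. {w \<in> topspace ?Y. w i \<in> S})" for S
  have closed_hit: "closedin ?Y (hit S)" if "closedin X S" for S
    unfolding hit_def using closedin_continuous_map_preimage[OF coordinate that]
    by (intro closedin_Union) auto
  have open_hit: "openin ?Y (hit S)" if "openin X S" for S
    unfolding hit_def using openin_continuous_map_preimage[OF coordinate that]
    by (intro openin_Union) auto
  have y_hit: "y p \<in> hit S \<longleftrightarrow> (\<exists>a\<in>p. x a \<in> S)" if "p \<in> B" for p S
  proof -
    have "x a \<in> topspace X" for a using V openin_subset by blast
    then have "y p \<in> topspace ?Y" by (simp add: y_def)
    then show ?thesis using y[OF that, of S] by (auto simp: hit_def)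
  qed
  show False
  proof (rule no_long_free_sequence[where Y = ?Y and B = B and less = block_less and y = y
        and K = "\<lambda>q. hit (\<Union>b\<in>q. K b)" and V = "\<lambda>q. hit (\<Union>b\<in>q. V b)"])
    show "compact_space ?Y" using compact by (simp add: compact_space_product_topology)
    show "countably_tight ?Y"
      using countably_tight_finite_power countable_spread_imp_countably_tight compact Haus spread by blast
    show "block_less p s" if "p \<in> B" "q \<in> B" "s \<in> B" "block_less p q" "block_less q s" for p q s
      using that elem[of q] seg_trans unfolding block_less_def by blast
    show "\<exists>q\<in>B. \<forall>p\<in>C. block_less p q" if "C \<subseteq> B" "countable C" for C
      using bounded that by blast
    show "closedin ?Y (hit (\<Union>b\<in>q. K b))" if "q \<in> B" for q
      using elem[OF that] K(1) by (intro closed_hit closedin_Union) auto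
    show "openin ?Y (hit (\<Union>b\<in>q. V b))" for q
      using V(1) by (intro open_hit openin_Union) auto
    show "hit (\<Union>b\<in>q. K b) \<subseteq> hit (\<Union>b\<in>q. V b)" for q using K(3) by (auto simp: hit_def)
    show "y p \<in> hit (\<Union>b\<in>q. K b)" if pq: "p \<in> B" "q \<in> B" "block_less p q" for p q
    proof -
      obtain a b where ab: "a \<in> p" "b \<in> q" "x a \<in> U b \<or> x b \<in> U a"
        using conflict[OF pq] by (auto simp: Q_def)
      have "a \<in> seg b" using pq(3) ab(1,2) by (simp add: block_less_def)
      then have "x b \<notin> V a" by (rule later)
      then have "x b \<notin> U a" using subset_trans[OF K(2) K(3)] by (meson subsetD)
      then have "x a \<in> K b" using ab(3) subsetD[OF K(2)] by metis
      then have "x a \<in> (\<Union>b\<in>q. K b)" using ab(2) by (rule UN_I[rotated])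
      then show ?thesis using y_hit[OF pq(1)] ab(1) by metis
    qed
    show "y p \<notin> hit (\<Union>b\<in>q. V b)" if "p \<in> B" "q \<in> B" "block_less q p" for p q
    proof -
      have "x a \<notin> V b" if "a \<in> p" "b \<in> q" for a b
        using \<open>block_less q p\<close> that by (intro later) (simp add: block_less_def)
      then show ?thesis using y_hit[OF that(1)] by simp
    qed
  qed
qed

text \<open>
  Deleting the point at infinity from a discrete subspace leaves a discrete subspace of \<open>X\<close>.
\<close>

lemma countable_spread_Alexandroff_compactification:
  assumes "countable_spread X"
  shows "countable_spread (Alexandroff_compactification X)"
  unfolding countable_spread_def
proof (intro allI impI)
  fix S assume S: "S \<subseteq> topspace (Alexandroff_compactification X)"
    and disc: "subtopology (Alexandroff_compactification X) S = discrete_topology S"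
  have "countable {x. Some x \<in> S}"
  proof (rule countable_spread_isolated[OF assms, where f = "\<lambda>x. x"])
    fix x assume "x \<in> {x. Some x \<in> S}"
    then have x: "Some x \<in> S" by simp
    then have "openin (subtopology (Alexandroff_compactification X) S) {Some x}" by (simp add: disc)
    then obtain W where W: "openin (Alexandroff_compactification X) W" "{Some x} = W \<inter> S"
      by (auto simp: openin_subtopology)
    then have "openin X {x \<in> topspace X. Some x \<in> W}"
      using openin_continuous_map_preimage[OF continuous_map_Some] by blast
    moreover have "x \<in> topspace X" using S x by auto
    ultimately show "\<exists>U. openin X U \<and> x \<in> U \<and> (\<forall>y\<in>{x. Some x \<in> S}. y \<noteq> x \<longrightarrow> y \<notin> U)"
      using W(2) by (intro exI[of _ "{x \<in> topspace X. Some x \<in> W}"]) blast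
  qed
  then have "countable (insert None (Some ` {x. Some x \<in> S}))" by simp
  moreover have "S \<subseteq> insert None (Some ` {x. Some x \<in> S})"
  proof
    fix s assume "s \<in> S"
    then show "s \<in> insert None (Some ` {x. Some x \<in> S})" by (cases s) auto
  qed
  ultimately show "countable S" by (rule countable_subset[rotated])
qed

text \<open>
  The space is open in its one-point compactification, to which hereditary Lindelofness applies.
\<close>

lemma countable_cover_compact_closure:
  assumes MA: "MA_omega1 TYPE(nat set)"
    and "locally_compact_space X" "Hausdorff_space X" "countable_spread X"
  obtains \<U> where "countable \<U>" "\<Union>\<U> = topspace X"
    "\<And>U. U \<in> \<U> \<Longrightarrow> openin X U \<and> (\<exists>K. compactin X K \<and> U \<subseteq> K)"
proof -
  define \<V> where "\<V> = {U. openin X U \<and> (\<exists>K. compactin X K \<and> U \<subseteq> K)}"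
  have cover: "\<Union>\<V> = topspace X"
  proof
    show "\<Union>\<V> \<subseteq> topspace X" by (rule Union_least) (use openin_subset in \<open>auto simp: \<V>_def\<close>)
    show "topspace X \<subseteq> \<Union>\<V>"
    proof
      fix x assume "x \<in> topspace X"
      then obtain U K where "openin X U" "compactin X K" "x \<in> U" "U \<subseteq> K"
        using assms(2) unfolding locally_compact_space_def by metis
      then show "x \<in> \<Union>\<V>" by (intro UnionI[of U]) (auto simp: \<V>_def)
    qed
  qed
  have "\<exists>\<W>\<subseteq>(`) Some ` \<V>. countable \<W> \<and> \<Union>\<W> = \<Union>((`) Some ` \<V>)"
  proof (rule MA_hereditarily_Lindelof[OF MA, where X = "Alexandroff_compactification X"])
    show "Hausdorff_space (Alexandroff_compactification X)"
      using assms by (simp add: Hausdorff_space_Alexandroff_compactification)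
    show "countable_spread (Alexandroff_compactification X)"
      using assms by (simp add: countable_spread_Alexandroff_compactification)
    show "openin (Alexandroff_compactification X) V" if "V \<in> (`) Some ` \<V>" for V
      using that by (auto simp: \<V>_def)
  qed simp
  then obtain \<W> where \<W>: "\<W> \<subseteq> (`) Some ` \<V>" "countable \<W>" "\<Union>\<W> = \<Union>((`) Some ` \<V>)"
    by metis
  then obtain \<U> where \<U>: "\<U> \<subseteq> \<V>" "countable \<U>" "\<W> = (`) Some ` \<U>"
    by (meson countable_subset_image)
  have "Some ` \<Union>\<U> = Some ` \<Union>\<V>" using \<W>(3) \<U>(3) by (simp add: image_Union)
  then have "\<Union>\<U> = topspace X" using cover by (simp add: inj_image_eq_iff)
  moreover have "openin X U \<and> (\<exists>K. compactin X K \<and> U \<subseteq> K)" if "U \<in> \<U>" for U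
    using \<U>(1) that by (auto simp: \<V>_def)
  ultimately show thesis using that \<U>(2) by metis
qed

section \<open>Compactness\<close>

lemma compactin_subset_increasing_open:
  fixes H :: "nat \<Rightarrow> 'a set"
  assumes K: "compactin X K" and H: "\<And>n. openin X (H n)" "mono H" "K \<subseteq> (\<Union>n. H n)"
  obtains m where "K \<subseteq> H m"
proof -
  obtain \<F> where "finite \<F>" "\<F> \<subseteq> range H" and cover: "K \<subseteq> \<Union>\<F>"
    using K H(1,3) unfolding compactin_def by (metis rangeE)
  then obtain N where N: "finite N" "\<F> = H ` N" by (meson finite_subset_image)
  have "H n \<subseteq> H (Max N)" if "n \<in> N" for n
    using that N(1) H(2) by (simp add: monoD)
  then have "\<Union>\<F> \<subseteq> H (Max N)" unfolding N(2) by (rule UN_least)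
  with cover show thesis using that by (meson order_trans)
qed

text \<open>
  Let \<open>H n\<close> be the increasing open stages of the cover and \<open>L n \<supseteq> H n\<close> compact.  If \<open>X\<close> is
  not compact, one can select stages \<open>s 0 < s 1 < \<dots>\<close> such that \<open>H (s (k+1))\<close> contains
  \<open>L (s k)\<close> and a point outside it.  The sets \<open>H (s (k+1)) - L (s k)\<close> form a cellular family,
  while a compact set is contained in some \<open>H m\<close> and so misses the \<open>m\<close>-th of them.
\<close>

lemma cellular_compact_imp_compact:
  assumes cc: "cellular_compact_space X" and Haus: "Hausdorff_space X"
    and \<U>: "countable \<U>" "\<Union>\<U> = topspace X"
    and bounded: "\<And>U. U \<in> \<U> \<Longrightarrow> openin X U \<and> (\<exists>K. compactin X K \<and> U \<subseteq> K)"
  shows "compact_space X"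
proof (rule ccontr)
  assume no: "\<not> compact_space X"
  then have "\<U> \<noteq> {}" using \<U>(2) by (auto simp: compact_space_def)
  define U where "U = from_nat_into \<U>"
  have range: "range U = \<U>" unfolding U_def using \<U>(1) \<open>\<U> \<noteq> {}\<close> by (rule range_from_nat_into[rotated])
  have U: "openin X (U n)" "\<exists>K. compactin X K \<and> U n \<subseteq> K" for n
    using bounded[of "U n"] range by auto
  then obtain K where K: "\<And>n. compactin X (K n)" "\<And>n. U n \<subseteq> K n" by metis
  define H where "H n = (\<Union>i<n. U i)" for n :: nat
  define L where "L n = (\<Union>i<n. K i)" for n :: nat
  have H: "openin X (H n)" for n using U(1) by (auto simp: H_def)
  have mono: "mono H" by (rule monoI) (force simp: H_def)
  have cover: "(\<Union>n. H n) = topspace X"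
  proof -
    have "(\<Union>n. H n) = (\<Union>i. U i)" by (auto simp: H_def)
    then show ?thesis using range \<U>(2) by simp
  qed
  have L: "compactin X (L n)" for n using K(1) by (auto simp: L_def intro!: compactin_Union)
  have HL: "H n \<subseteq> L n" for n using K(2) by (force simp: H_def L_def)
  have "\<exists>m>n. L n \<subseteq> H m \<and> H m - L n \<noteq> {}" for n
  proof -
    have "L n \<noteq> topspace X" using no L[of n] by (auto simp: compact_space_def)
    then obtain x where x: "x \<in> topspace X" "x \<notin> L n" using compactin_subset_topspace[OF L] by blast
    then obtain m1 where m1: "x \<in> H m1" using cover by blast
    obtain m2 where m2: "L n \<subseteq> H m2"
      using compactin_subset_increasing_open[OF L H mono] cover compactin_subset_topspace[OF L] by metis
    let ?m = "Suc (max n (max m1 m2))"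
    have "H m1 \<subseteq> H ?m" "H m2 \<subseteq> H ?m" using mono by (simp_all add: monoD)
    then have "L n \<subseteq> H ?m" "x \<in> H ?m - L n" using m1 m2 x by auto
    moreover have "n < ?m" by simp
    ultimately show ?thesis by blast
  qed
  then obtain t where t: "\<And>n. t n > n" "\<And>n. L n \<subseteq> H (t n)" "\<And>n. H (t n) - L n \<noteq> {}" by metis
  define s where "s k = (t ^^ k) 0" for k
  have s_Suc: "s (Suc k) = t (s k)" for k by (simp add: s_def)
  have s_mono: "strict_mono s" by (rule strict_monoI_Suc) (simp add: s_Suc t(1))
  define A where "A k = H (s (Suc k)) - L (s k)" for k
  have disj: "A j \<inter> A k = {}" if "j < k" for j k
  proof -
    have "s (Suc j) \<le> s k" using that s_mono by (simp add: strict_mono_less_eq)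
    then have "H (s (Suc j)) \<subseteq> L (s k)" using monoD[OF mono] HL by blast
    then show ?thesis by (auto simp: A_def)
  qed
  have "cellular_family X (range A)"
    unfolding cellular_family_def
  proof (intro conjI ballI)
    fix V assume "V \<in> range A"
    then obtain k where k: "V = A k" by blast
    show "openin X V" unfolding k A_def using H compactin_imp_closedin[OF Haus L] by (intro openin_diff)
    show "V \<noteq> {}" unfolding k A_def s_Suc by (rule t(3))
  next
    show "pairwise disjnt (range A)"
      unfolding pairwise_def disjnt_def using disj by (metis Int_commute linorder_neqE_nat rangeE)
  qed
  then obtain C where C: "compactin X C" "\<And>k. C \<inter> A k \<noteq> {}"
    using cc unfolding cellular_compact_space_def by (metis rangeI)
  obtain m where m: "C \<subseteq> H m"
    using compactin_subset_increasing_open[OF C(1) H mono] cover compactin_subset_topspace[OF C(1)] by metis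
  have "H m \<subseteq> H (s m)" using mono strict_mono_imp_increasing[OF s_mono] by (simp add: monoD)
  then have "C \<inter> A m = {}" using m HL[of "s m"] by (auto simp: A_def)
  with C(2) show False by blast
qed

theorem corollary3p5:
  fixes X :: "'a topology"
  assumes "MA_omega1 TYPE(nat set)"
    and "locally_compact_space X"
    and "cellular_compact_space X"
    and "Hausdorff_space X"
    and "countable_spread X"
  shows "compact_space X"
proof -
  obtain \<U> where "countable \<U>" "\<Union>\<U> = topspace X"
    "\<And>U. U \<in> \<U> \<Longrightarrow> openin X U \<and> (\<exists>K. compactin X K \<and> U \<subseteq> K)"
    using countable_cover_compact_closure[OF assms(1,2,4,5)] by metis
  then show ?thesis by (rule cellular_compact_imp_compact[OF assms(3,4)])
qed

end
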